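(* Let $X$ be a Hunt process in $\mathbb{R}^d$ and let $q:\mathbb{R}^d\to\mathbb{R}$ be Borel. Then $q\in\mathcal{K}(X)$ if and only if $$\lim_{r\to0^+}\Big[\sup_{x\in\mathbb{R}^d}\int_{B(x,r)}|q(z)|\,G_t^\lambda(x,dz)\Big]=0$$ for some (equivalently, for all) $t\in(0,\infty)$ and $\lambda\ge0$.
   Context: $P_u(x,B)=\mathbb{P}^x(X_u\in B)$ is the transition kernel; for $\lambda\ge0$ and $t\in(0,\infty]$, $G_t^\lambda(x,B)=\int_0^te^{-\lambda u}P_u(x,B)\,du$, and $G^\lambda=G^\lambda_\infty$. $B(x,r)$ is the open Euclidean ball. $q\in\mathcal{K}(X)$ means that for some (equivalently, for every) $\lambda>0$, $\lim_{r\to0^+}\sup_{x\in\mathbb{R}^d}\int_{B(x,r)}|q(z)|\,G^\lambda(x,dz)=0$. *)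

theory Defs
  imports "HOL-Probability.Probability"
begin

text \<open>
  The state space is the one-point compactification of a Euclidean space. The cemetery point is
  \<^term>\<open>None\<close>, and a state \<open>x\<close> of the Euclidean space is \<^term>\<open>Some x\<close>.
\<close>

abbreviation state_topology :: "'a::euclidean_space option topology" where
  "state_topology \<equiv> Alexandroff_compactification euclidean"

definition state_borel :: "'a::euclidean_space option measure" where
  "state_borel = sigma UNIV {U. openin state_topology U}"

text \<open>
  A Hunt process \<open>(\<Omega>, M, F\<^sub>t, X\<^sub>t, \<theta>\<^sub>t, P\<^sup>x)\<close>, where \<open>\<Omega>\<close> is \<^term>\<open>space M\<close>. Time ranges over
  \<open>[0, \<infinity>]\<close>, that is over \<^typ>\<open>ennreal\<close>, so that stopping times may be infinite, with
  \<open>X\<^sub>\<infinity> = None\<close>. The filtration is not required to be complete. The simple Markov property is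
  the case of a constant stopping time \<open>T\<close> in the strong one, and the strong Markov property under
  an initial distribution \<open>\<mu>\<close> follows from the one under all \<open>P\<^sup>x\<close> by integration against \<open>\<mu>\<close>.
\<close>

locale hunt_process = filtration "space M" F
  for M :: "'w measure"
    and F :: "ennreal \<Rightarrow> 'w measure"
    and X :: "ennreal \<Rightarrow> 'w \<Rightarrow> 'a::euclidean_space option"
    and \<theta> :: "ennreal \<Rightarrow> 'w \<Rightarrow> 'w"
    and P :: "'a option \<Rightarrow> 'w measure" +
  assumes prob_space_P: "\<And>x. prob_space (P x)"
    and sets_P: "\<And>x. sets (P x) = sets M"
    and sets_F_subset: "\<And>t. sets (F t) \<subseteq> sets M"
    and F_right_continuous: "\<And>t. t < \<infinity> \<Longrightarrow> sets (F t) = (\<Inter>s\<in>{t<..}. sets (F s))"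
    and X_adapted: "\<And>t. X t \<in> measurable (F t) state_borel"
    and P_measurable: "\<And>t B. t < \<infinity> \<Longrightarrow> B \<in> sets borel \<Longrightarrow>
          (\<lambda>x. measure (P (Some x)) {\<omega>\<in>space M. X t \<omega> \<in> Some ` B}) \<in> borel_measurable borel"
    and X_infinity: "\<And>\<omega>. \<omega> \<in> space M \<Longrightarrow> X \<infinity> \<omega> = None"
    and X_absorbed: "\<And>s t \<omega>. \<omega> \<in> space M \<Longrightarrow> X s \<omega> = None \<Longrightarrow> s \<le> t \<Longrightarrow> X t \<omega> = None"
    and shift_space: "\<And>t \<omega>. \<omega> \<in> space M \<Longrightarrow> \<theta> t \<omega> \<in> space M"
    and X_shift: "\<And>s t \<omega>. \<omega> \<in> space M \<Longrightarrow> X s (\<theta> t \<omega>) = X (t + s) \<omega>"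
    and normal: "\<And>x. AE \<omega> in P x. X 0 \<omega> = x"
    and right_continuous_paths: "\<And>t \<omega>. \<omega> \<in> space M \<Longrightarrow> t < \<infinity> \<Longrightarrow>
          limitin state_topology (\<lambda>s. X s \<omega>) (X t \<omega>) (at_right t)"
    and left_limits: "\<And>t \<omega>. \<omega> \<in> space M \<Longrightarrow> 0 < t \<Longrightarrow> t < \<infinity> \<Longrightarrow>
          \<exists>l. limitin state_topology (\<lambda>s. X s \<omega>) l (at_left t)"
    and X_stopping_time_measurable: "\<And>T. stopping_time F T \<Longrightarrow>
          (\<lambda>\<omega>. X (T \<omega>) \<omega>) \<in> measurable (pre_sigma T) state_borel"
    and strong_markov: "\<And>x T s B. stopping_time F T \<Longrightarrow> s < \<infinity> \<Longrightarrow> B \<in> sets state_borel \<Longrightarrow>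
          AE \<omega> in P x.
            real_cond_exp (P x) (pre_sigma T) (indicator {\<omega>'\<in>space M. X (T \<omega>' + s) \<omega>' \<in> B}) \<omega> =
            measure (P (X (T \<omega>) \<omega>)) {\<omega>'\<in>space M. X s \<omega>' \<in> B}"
    and quasi_left_continuous: "\<And>x T. (\<And>n. stopping_time F (T n)) \<Longrightarrow>
          (\<And>\<omega>. \<omega> \<in> space M \<Longrightarrow> incseq (\<lambda>n. T n \<omega>)) \<Longrightarrow>
          AE \<omega> in P x. (SUP n. T n \<omega>) < \<infinity> \<longrightarrow>
            limitin state_topology (\<lambda>n. X (T n \<omega>) \<omega>) (X (SUP n. T n \<omega>) \<omega>) sequentially"

text \<open>
  The kernels below are carried by the Euclidean space; mass at the cemetery is dropped. The
  process enters through \<open>M\<close>, \<open>X\<close> and \<open>P\<close> only.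
\<close>

definition transition_kernel ::
    "'w measure \<Rightarrow> (ennreal \<Rightarrow> 'w \<Rightarrow> 'a::euclidean_space option) \<Rightarrow> ('a option \<Rightarrow> 'w measure) \<Rightarrow>
     ennreal \<Rightarrow> 'a \<Rightarrow> 'a measure" where
  "transition_kernel M X P u x =
     measure_of UNIV (sets borel) (\<lambda>B. emeasure (P (Some x)) {\<omega>\<in>space M. X u \<omega> \<in> Some ` B})"

definition potential_kernel ::
    "'w measure \<Rightarrow> (ennreal \<Rightarrow> 'w \<Rightarrow> 'a::euclidean_space option) \<Rightarrow> ('a option \<Rightarrow> 'w measure) \<Rightarrow>
     real \<Rightarrow> ennreal \<Rightarrow> 'a \<Rightarrow> 'a measure" where
  "potential_kernel M X P lam t x =
     measure_of UNIV (sets borel)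
       (\<lambda>B. \<integral>\<^sup>+u\<in>{u. 0 \<le> u \<and> ennreal u < t}.
          ennreal (exp (- lam * u)) * emeasure (transition_kernel M X P (ennreal u) x) B \<partial>lborel)"

definition locally_uniformly_small ::
    "('a::euclidean_space \<Rightarrow> real) \<Rightarrow> ('a \<Rightarrow> 'a measure) \<Rightarrow> bool" where
  "locally_uniformly_small q K \<longleftrightarrow>
     ((\<lambda>r. SUP x. \<integral>\<^sup>+z\<in>ball x r. ennreal \<bar>q z\<bar> \<partial>K x) \<longlongrightarrow> 0) (at_right (0::real))"

definition kato_class ::
    "'w measure \<Rightarrow> (ennreal \<Rightarrow> 'w \<Rightarrow> 'a::euclidean_space option) \<Rightarrow> ('a option \<Rightarrow> 'w measure) \<Rightarrow>
     ('a \<Rightarrow> real) set" where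
  "kato_class M X P =
     {q \<in> borel_measurable borel.
        \<exists>lam>0. locally_uniformly_small q (potential_kernel M X P lam \<infinity>)}"

end

theory Submission
  imports Defs
begin

text \<open>
  Only the direction from a finite horizon \<open>t\<close> to the resolvent needs work. Put \<open>\<mu> = \<lambda> + 1\<close>,
  \<open>B = B(x, r)\<close>, \<open>f = |q| 1\<^sub>B\<close>, and cut \<open>[0, \<infinity>)\<close> into blocks \<open>[n t, (n + 1) t)\<close>. In each block
  nothing is collected before the first visit of the path to \<open>B\<close>, and by the Markov property at that
  visit at most \<open>exp(- \<mu> n t)\<close> times the supremum of \<open>G\<^sub>t f\<close> over \<open>B\<close> is collected afterwards. Since \<open>B(x, r) \<subseteq> B(y, 2 r)\<close> for
  \<open>y \<in> B\<close>, the geometric series bounds the quantity for the resolvent at \<open>r\<close> by a constant multiple of the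
  one for \<open>G\<^sub>t\<close> at \<open>2 r\<close>. The first visit is taken along finite sets of times that increase to a
  dense set. The path is right-continuous and \<open>B\<close> is open, so in the limit at most one instant is missed,
  and the Markov property is only needed at constant times.
\<close>

subsection \<open>Kernels and the compactified state space\<close>

text \<open>The indicator of a bounded open set is an increasing limit of admissible test functions,
  and these sets form an intersection-stable generator of the Borel sets. Tests of bounded support
  are used because, extended by 0, they stay continuous at the cemetery point.\<close>

lemma measurable_kernel_compact_support:
  fixes K :: "'i \<Rightarrow> 'a::euclidean_space measure"
  assumes subprob: "\<And>i. i \<in> space N \<Longrightarrow> subprob_space (K i)"
    and sets: "\<And>i. i \<in> space N \<Longrightarrow> sets (K i) = sets borel"
    and test: "\<And>g::'a \<Rightarrow> real. continuous_on UNIV g \<Longrightarrow> (\<And>z. 0 \<le> g z) \<Longrightarrow> (\<And>z. g z \<le> 1) \<Longrightarrow>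
      bounded {z. g z \<noteq> 0} \<Longrightarrow> (\<lambda>i. \<integral>\<^sup>+z. ennreal (g z) \<partial>K i) \<in> borel_measurable N"
  shows "K \<in> measurable N (subprob_algebra borel)"
proof -
  have U: "(\<lambda>i. emeasure (K i) U) \<in> borel_measurable N" if U: "open U" "bounded U" for U
  proof -
    define g where "g m z = min 1 (real m * infdist z (- U))" for m z
    \<comment> \<open>Uses that \<open>U\<close> is bounded. Since \<open>infdist\<close> to the
      empty set is 0 by convention, it could not detect membership in \<open>U\<close> if the
      complement were empty.\<close>
    have ne: "- U \<noteq> {}" using U not_bounded_UNIV by (metis Compl_UNIV_eq double_complement)
    have cl: "closed (- U)" using U by auto
    have pos: "infdist z (- U) > 0 \<longleftrightarrow> z \<in> U" for z
      using in_closed_iff_infdist_zero[OF cl ne, of z] infdist_nonneg[of z "- U"] by auto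
    have m: "(\<lambda>i. \<integral>\<^sup>+z. ennreal (g m z) \<partial>K i) \<in> borel_measurable N" for m
    proof (rule test)
      show "continuous_on UNIV (g m)" unfolding g_def by (intro continuous_intros)
      show "0 \<le> g m z" "g m z \<le> 1" for z unfolding g_def by (auto simp: infdist_nonneg)
      show "bounded {z. g m z \<noteq> 0}"
      proof (rule bounded_subset[OF U(2)], rule subsetI)
        fix z assume "z \<in> {z. g m z \<noteq> 0}"
        then have "infdist z (- U) \<noteq> 0" by (auto simp: g_def)
        then show "z \<in> U" using pos infdist_nonneg[of z "- U"] by force
      qed
    qed
    have ind: "(SUP m. ennreal (g m z)) = indicator U z" for z
    proof (cases "z \<in> U")
      case True
      then obtain m :: nat where "1 < real m * infdist z (- U)"
        using pos[of z] reals_Archimedean3 by blast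
      then have "ennreal (g m z) = 1" by (simp add: g_def)
      then have "1 \<le> (SUP m. ennreal (g m z))" by (metis SUP_upper UNIV_I)
      moreover have "(SUP m. ennreal (g m z)) \<le> 1"
        by (rule SUP_least) (simp add: g_def)
      ultimately show ?thesis using True by simp
    next
      case False
      then have "infdist z (- U) = 0" using pos infdist_nonneg[of z "- U"] by force
      then show ?thesis using False by (simp add: g_def)
    qed
    have "emeasure (K i) U = (SUP m. \<integral>\<^sup>+z. ennreal (g m z) \<partial>K i)" if i: "i \<in> space N" for i
    proof -
      have [measurable]: "(\<lambda>z. ennreal (g m z)) \<in> borel_measurable (K i)" for m
        unfolding measurable_cong_sets[OF sets[OF i] refl] g_def
        by (intro measurable_compose[OF _ measurable_ennreal] borel_measurable_continuous_onI
            continuous_intros)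
      have "emeasure (K i) U = (\<integral>\<^sup>+z. (SUP m. ennreal (g m z)) \<partial>K i)"
        using U sets[OF i] by (simp add: ind)
      also have "\<dots> = (SUP m. \<integral>\<^sup>+z. ennreal (g m z) \<partial>K i)"
      proof (rule nn_integral_monotone_convergence_SUP)
        show "incseq (\<lambda>m z. ennreal (g m z))"
          by (auto simp: incseq_def le_fun_def g_def
              intro!: ennreal_leI min.mono mult_right_mono infdist_nonneg)
      qed simp
      finally show ?thesis .
    qed
    then show ?thesis
      using m by (subst measurable_cong) auto
  qed
  show ?thesis
  proof (rule measurable_subprob_algebra_generated)
    show "sets borel = sigma_sets UNIV {U::'a set. open U \<and> bounded U}"
    proof
      show "sets borel \<subseteq> sigma_sets UNIV {U::'a set. open U \<and> bounded U}"
        unfolding borel_eq_box by (auto intro!: sigma_sets_mono' open_box)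
      show "sigma_sets UNIV {U::'a set. open U \<and> bounded U} \<subseteq> sets borel"
        by (rule sets.sigma_sets_subset[of _ borel, simplified]) auto
    qed
    show "Int_stable {U::'a set. open U \<and> bounded U}"
      by (auto simp: Int_stable_def)
    \<comment> \<open>The whole space is unbounded and so not in the generator; its mass is the
      limit of the masses of growing balls.\<close>
    have "emeasure (K i) UNIV = (SUP n. emeasure (K i) (ball 0 (real n)))" if "i \<in> space N" for i
    proof -
      have "(\<Union>n. ball (0::'a) (real n)) = UNIV"
        using reals_Archimedean2 by auto
      then show ?thesis
        using sets[OF that] by (subst SUP_emeasure_incseq) (auto simp: incseq_def)
    qed
    then show "(\<lambda>i. emeasure (K i) UNIV) \<in> borel_measurable N"
      using U[OF open_ball bounded_ball] by (subst measurable_cong) auto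
  qed (use subprob sets U in auto)
qed

text \<open>Replace the time by the next point to its right on the grid of mesh
  \<open>1 / Suc n\<close>. Each approximation glues countably many functions that are measurable at
  a fixed time, and right continuity gives pointwise convergence.\<close>

lemma measurable_right_continuous:
  fixes \<phi> :: "ennreal \<Rightarrow> 'b \<Rightarrow> real"
  assumes meas: "\<And>t. t < \<infinity> \<Longrightarrow> \<phi> t \<in> borel_measurable N"
    and lim: "\<And>t b \<tau>. t < \<infinity> \<Longrightarrow> b \<in> space N \<Longrightarrow> (\<And>n. t < \<tau> n) \<Longrightarrow> \<tau> \<longlonglongrightarrow> t \<Longrightarrow>
      (\<lambda>n. \<phi> (\<tau> n) b) \<longlonglongrightarrow> \<phi> t b"
  shows "(\<lambda>(u, b). \<phi> (ennreal u) b) \<in> borel_measurable (borel \<Otimes>\<^sub>M N)"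
proof -
  define k where "k n u = nat \<lfloor>real (Suc n) * u\<rfloor>" for n and u :: real
  \<comment> \<open>The \<open>+ 1\<close> puts the grid point strictly to the right of
    \<open>u\<close>, as \<open>lim\<close> demands.\<close>
  define \<tau> where "\<tau> n i = ennreal ((real i + 1) / real (Suc n))" for n i :: nat
  have [measurable]: "k n \<in> measurable borel (count_space UNIV)" for n
    unfolding k_def by measurable
  have [measurable]: "\<phi> (\<tau> n i) \<in> borel_measurable N" for n i
    by (rule meas) (simp add: \<tau>_def)
  have \<tau>: "ennreal u < \<tau> n (k n u)" "(\<lambda>n. \<tau> n (k n u)) \<longlonglongrightarrow> ennreal u" for n u
  proof -
    \<comment> \<open>\<open>ennreal\<close> sends a negative real to 0, and \<open>nat\<close> does
      the same to the index \<open>k n u\<close>, so a negative \<open>u\<close> behaves like time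
      0.\<close>
    define v where "v = max 0 u"
    have kv: "real (k n u) = real_of_int \<lfloor>real (Suc n) * v\<rfloor>" for n
    proof (cases "u \<ge> 0")
      case True
      then have "0 \<le> real (Suc n) * u" by (intro mult_nonneg_nonneg) auto
      then show ?thesis using True unfolding k_def v_def
        by (simp add: max_def del: of_nat_Suc)
    next
      case False
      then have "real (Suc n) * u \<le> 0" by (intro mult_nonneg_nonpos) auto
      then have "nat \<lfloor>real (Suc n) * u\<rfloor> = 0" by (simp del: of_nat_Suc)
      then show ?thesis using False unfolding k_def v_def by (simp del: of_nat_Suc)
    qed
    have lo: "v < (real (k n u) + 1) / real (Suc n)" for n
      unfolding kv by (simp add: field_simps del: of_nat_Suc) linarith
    have hi: "(real (k n u) + 1) / real (Suc n) \<le> v + 1 / real (Suc n)" for n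
      unfolding kv by (simp add: field_simps del: of_nat_Suc) 
    have "ennreal u = ennreal v" by (simp add: v_def max_def ennreal_neg)
    moreover have "0 \<le> v" by (simp add: v_def)
    moreover have "(\<lambda>n. (real (k n u) + 1) / real (Suc n)) \<longlonglongrightarrow> v"
    proof (rule tendsto_sandwich)
      show "\<forall>\<^sub>F n in sequentially. v \<le> (real (k n u) + 1) / real (Suc n)"
        using lo by (auto intro: always_eventually less_imp_le)
      show "\<forall>\<^sub>F n in sequentially. (real (k n u) + 1) / real (Suc n) \<le> v + 1 / real (Suc n)"
        using hi by (auto intro: always_eventually)
      show "(\<lambda>n. v + 1 / real (Suc n)) \<longlonglongrightarrow> v"
        using tendsto_add[OF tendsto_const LIMSEQ_inverse_real_of_nat, of v]
        by (simp add: inverse_eq_divide)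
    qed simp
    ultimately show "ennreal u < \<tau> n (k n u)" "(\<lambda>n. \<tau> n (k n u)) \<longlonglongrightarrow> ennreal u"
      unfolding \<tau>_def using lo by (auto intro!: tendsto_ennrealI simp: ennreal_less_iff)
  qed
  have "(\<lambda>x. \<phi> (\<tau> n (k n (fst x))) (snd x)) \<in> borel_measurable (borel \<Otimes>\<^sub>M N)" for n
    by (rule measurable_compose_countable[where f="\<lambda>i x. \<phi> (\<tau> n i) (snd x)"]) measurable
  then have "(\<lambda>x. \<phi> (ennreal (fst x)) (snd x)) \<in> borel_measurable (borel \<Otimes>\<^sub>M N)"
    by (rule borel_measurable_LIMSEQ_real[rotated])
       (auto simp: space_pair_measure intro!: lim \<tau>)
  then show ?thesis by (simp add: case_prod_beta')
qed

text \<open>Extended by 0 at \<open>None\<close>, \<open>g\<close> is continuous on the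
  compactification. If an open \<open>V\<close> misses 0, its preimage is an open set of Euclidean
  points. If \<open>V\<close> contains 0, the complement of the preimage is closed and lies in the
  bounded set where \<open>g\<close> is nonzero, hence is compact, so the preimage is open around
  \<open>None\<close>.\<close>

lemma tendsto_case_option_state:
  fixes g :: "'a::euclidean_space \<Rightarrow> real"
  assumes g: "continuous_on UNIV g" "bounded {z. g z \<noteq> 0}"
    and lim: "limitin state_topology Y l F"
  shows "((\<lambda>s. case_option 0 g (Y s)) \<longlongrightarrow> case_option 0 g l) F"
proof -
  have "continuous_map state_topology euclidean (case_option 0 g)"
    unfolding continuous_map_alt
  proof (intro conjI allI impI)
    fix V :: "real set" assume "openin euclidean V"
    then have V: "open V" by simp
    show "openin state_topology (case_option 0 g -` V \<inter> topspace state_topology)"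
    proof (cases "0 \<in> V")
      case False
      then have "case_option 0 g -` V \<inter> topspace state_topology = Some ` (g -` V)"
        by (auto split: option.splits)
      then show ?thesis using g V
        by (simp add: open_vimage)
    next
      case True
      have cl: "closed (g -` (- V))" using g V by (intro closed_vimage) auto
      have "compact (g -` (- V))"
        using cl bounded_subset[OF g(2), of "g -` (- V)"] True
        by (force simp: compact_eq_bounded_closed)
      moreover have "case_option 0 g -` V \<inter> topspace state_topology
          = insert None (Some ` (topspace euclidean - g -` (- V)))"
        using True by (auto split: option.splits)
      ultimately show ?thesis using cl
        by (auto simp: openin_Alexandroff_compactification)
    qed
  qed simp
  from continuous_map_limit[OF this lim] show ?thesis by (simp add: o_def)
qed

section \<open>Borel sets of the compactified space\<close>

lemma sets_state_borel: "sets state_borel = sigma_sets UNIV {U. openin state_topology U}"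
  by (simp add: state_borel_def)

lemma space_state_borel [simp]: "space state_borel = UNIV"
  by (simp add: state_borel_def)

lemma Some_image_borel [measurable]:
  fixes B :: "'a::euclidean_space set"
  assumes "B \<in> sets borel"
  shows "Some ` B \<in> sets state_borel"
proof -
  have "B \<in> sigma_sets UNIV {S. open S}"
    using assms by (simp add: borel_def)
  then show ?thesis
  proof induction
    case (Basic a)
    then show ?case by (auto simp: sets_state_borel)
  next
    case Empty
    then show ?case by simp
  next
    case (Compl a)
    have "Some ` (UNIV :: 'a set) \<in> sets state_borel" 
      unfolding sets_state_borel by (intro sigma_sets.Basic) simp
    moreover have "Some ` (UNIV - a) = Some ` UNIV - Some ` a" by auto
    ultimately show ?case using Compl by (auto simp only: sets.Diff)
  next
    case (Union a)
    then show ?case by (simp add: image_UN)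
  qed
qed

lemma None_state_borel [measurable]: "{None} \<in> sets (state_borel :: 'a::euclidean_space option measure)"
proof -
  have "{None} = space state_borel - Some ` (UNIV :: 'a set)"
    by (auto simp: UNIV_option_conv)
  then show ?thesis by (simp only: ) (intro sets.compl_sets Some_image_borel, simp)
qed

lemma measurable_the_state [measurable]:
  "the \<in> measurable state_borel (borel :: 'a::euclidean_space measure)"
proof (rule measurableI)
  fix B :: "'a set" assume B: "B \<in> sets borel"
  \<comment> \<open>\<open>the None\<close> is an unspecified point that may or may not lie in
    \<open>B\<close>.\<close>
  have "the -` B \<inter> space state_borel = Some ` B \<union> (if the None \<in> B then {None} else {})"
    by (auto simp: image_iff split: if_splits) (metis option.collapse)+
  also have "\<dots> \<in> sets state_borel"
    using B by (intro sets.Un) auto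
  finally show "the -` B \<inter> space state_borel \<in> sets state_borel" .
qed simp

lemma measurable_case_option_state [measurable]:
  fixes f :: "'b::euclidean_space \<Rightarrow> 'c::{topological_space, zero}"
  assumes [measurable]: "f \<in> borel_measurable borel"
  shows "case_option 0 f \<in> borel_measurable state_borel"
proof -
  have "case_option 0 f = (\<lambda>y. if y \<in> {None} then 0 else f (the y))"
    by (auto split: option.splits)
  also have "\<dots> \<in> borel_measurable state_borel"
    by measurable
  finally show ?thesis .
qed

text \<open>A squeeze argument common to both directions of the theorem. The factor \<open>m\<close>
  leaves room for enlarging the balls, and finiteness of \<open>c\<close> makes multiplication by
  \<open>c\<close> preserve convergence to 0.\<close>

lemma locally_uniformly_small_mono:
  assumes small: "locally_uniformly_small q K'" and c: "c < \<infinity>" and m: "0 < m"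
    and le: "\<And>x r. 0 < r \<Longrightarrow> (\<integral>\<^sup>+z\<in>ball x r. ennreal \<bar>q z\<bar> \<partial>K x)
      \<le> c * (SUP y. \<integral>\<^sup>+z\<in>ball y (m * r). ennreal \<bar>q z\<bar> \<partial>K' y)"
  shows "locally_uniformly_small q K"
  unfolding locally_uniformly_small_def
proof -
  let ?S = "\<lambda>r. SUP y. \<integral>\<^sup>+z\<in>ball y r. ennreal \<bar>q z\<bar> \<partial>K' y"
  have "filterlim (\<lambda>r. m * r) (at_right 0) (at_right (0::real))"
    unfolding filterlim_at
  proof
    show "\<forall>\<^sub>F r in at_right 0. m * r \<in> {0<..} \<and> m * r \<noteq> 0"
      using eventually_at_right_less[of "0::real"] by eventually_elim (use m in auto)
    show "((\<lambda>r. m * r) \<longlongrightarrow> 0) (at_right 0)"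
      by (auto intro!: tendsto_eq_intros)
  qed
  then have "((\<lambda>r. ?S (m * r)) \<longlongrightarrow> 0) (at_right 0)"
    by (rule filterlim_compose[OF small[unfolded locally_uniformly_small_def]])
  then have lim: "((\<lambda>r. c * ?S (m * r)) \<longlongrightarrow> 0) (at_right 0)"
    using ennreal_tendsto_cmult[of c "\<lambda>r. ?S (m * r)" 0] c by simp
  have "\<forall>\<^sub>F r in at_right 0. (SUP x. \<integral>\<^sup>+z\<in>ball x r. ennreal \<bar>q z\<bar> \<partial>K x) \<le> c * ?S (m * r)"
    using eventually_at_right_less[of "0::real"] by eventually_elim (intro SUP_least le)
  then show "((\<lambda>r. SUP x. \<integral>\<^sup>+z\<in>ball x r. ennreal \<bar>q z\<bar> \<partial>K x) \<longlongrightarrow> 0) (at_right 0)"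
    by (intro tendsto_sandwich[OF _ _ tendsto_const lim]) auto
qed

lemma measurable_abs_indicator_ball:
  fixes q :: "'b::euclidean_space \<Rightarrow> real"
  assumes "q \<in> borel_measurable borel"
  shows "(\<lambda>z. ennreal \<bar>q z\<bar> * indicator (ball x r) z) \<in> borel_measurable borel"
  using assms by (intro borel_measurable_times_ennreal borel_measurable_indicator) auto

context hunt_process
begin

abbreviation K :: "ennreal \<Rightarrow> 'a \<Rightarrow> 'a measure" where
  "K \<equiv> transition_kernel M X P"

abbreviation G :: "real \<Rightarrow> ennreal \<Rightarrow> 'a \<Rightarrow> 'a measure" where
  "G \<equiv> potential_kernel M X P"

section \<open>The transition kernel as an image measure\<close>

lemma space_P: "space (P x) = space M"
  using sets_P by (rule sets_eq_imp_space_eq)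

lemma X_measurable: "X t \<in> measurable M state_borel"
  using measurable_from_subalg[of M "F t"] X_adapted[of t] sets_F_subset[of t] space_F[of t]
  by (auto simp: subalgebra_def)

lemma X_measurable_P [measurable]: "X t \<in> measurable (P x) state_borel"
  using X_measurable[of t] measurable_cong_sets[OF sets_P refl] by blast

lemma X_in_sets_F: "B \<in> sets state_borel \<Longrightarrow> {\<omega> \<in> space M. X t \<omega> \<in> B} \<in> sets (F t)"
  using measurable_sets[OF X_adapted, of B t]
  by (simp add: vimage_def Int_def space_F conj_commute)

lemma alive_measurable [measurable]: "{\<omega> \<in> space M. X u \<omega> \<noteq> None} \<in> sets (P x)"
proof -
  have "{\<omega> \<in> space (P x). X u \<omega> \<notin> {None}} \<in> sets (P x)"
    by measurable
  then show ?thesis by (simp add: space_P)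
qed

text \<open>\<open>measure_of\<close> keeps a set function only if it is countably additive. Writing
  the kernel as the image of \<open>P (Some x)\<close> restricted to the paths alive at time
  \<open>u\<close> settles this without a separate proof.\<close>

lemma transition_kernel_eq_distr:
  "K u x = distr (density (P (Some x)) (indicator {\<omega> \<in> space M. X u \<omega> \<noteq> None})) borel
     (\<lambda>\<omega>. the (X u \<omega>))" (is "_ = ?D")
proof -
  have "K u x = measure_of UNIV (sets borel) (emeasure ?D)"
    unfolding transition_kernel_def
  proof (rule measure_of_eq)
    fix B :: "'a set" assume "B \<in> sigma_sets UNIV (sets borel)"
    then have B [measurable]: "B \<in> sets borel"
      by (metis sets.sigma_sets_eq space_borel)
    have "{\<omega> \<in> space M. X u \<omega> \<in> Some ` B} =
        {\<omega> \<in> space M. X u \<omega> \<noteq> None} \<inter> ((\<lambda>\<omega>. the (X u \<omega>)) -` B \<inter> space (P (Some x)))"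
      by (auto simp: space_P)
    moreover have "(\<lambda>\<omega>. the (X u \<omega>)) -` B \<inter> space (P (Some x)) \<in> sets (P (Some x))"
      by measurable
    ultimately show "emeasure (P (Some x)) {\<omega> \<in> space M. X u \<omega> \<in> Some ` B} = emeasure ?D B"
      using emeasure_density[of "indicator {\<omega> \<in> space M. X u \<omega> \<noteq> None}" "P (Some x)"
        "(\<lambda>\<omega>. the (X u \<omega>)) -` B \<inter> space (P (Some x))"]
      by (simp add: emeasure_distr indicator_inter_arith[symmetric] del: not_None_eq)
  qed simp
  also have "\<dots> = ?D"
    using measure_of_of_measure[of ?D] by simp
  finally show ?thesis .
qed

lemma sets_K [simp, measurable_cong]: "sets (K u x) = sets borel"
  by (simp add: transition_kernel_eq_distr)

lemma space_K [simp]: "space (K u x) = UNIV"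
  by (simp add: transition_kernel_eq_distr)

lemma nn_integral_K:
  assumes [measurable]: "f \<in> borel_measurable borel"
  shows "(\<integral>\<^sup>+z. f z \<partial>K u x) = (\<integral>\<^sup>+\<omega>. case_option 0 f (X u \<omega>) \<partial>P (Some x))"
proof -
  show ?thesis
    unfolding transition_kernel_eq_distr
    by (simp add: nn_integral_distr nn_integral_density del: not_None_eq)
       (auto intro!: nn_integral_cong simp: space_P indicator_def split: option.splits)
qed

lemma emeasure_K:
  assumes "B \<in> sets borel"
  shows "emeasure (K u x) B = emeasure (P (Some x)) {\<omega> \<in> space M. X u \<omega> \<in> Some ` B}"
proof -
  have "emeasure (K u x) B = (\<integral>\<^sup>+\<omega>. case_option 0 (indicator B) (X u \<omega>) \<partial>P (Some x))"
    using assms by (subst nn_integral_K[symmetric]) auto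
  also have "\<dots> = (\<integral>\<^sup>+\<omega>. indicator {\<omega> \<in> space M. X u \<omega> \<in> Some ` B} \<omega> \<partial>P (Some x))"
    by (rule nn_integral_cong) (auto simp: space_P indicator_def split: option.splits)
  also have "\<dots> = emeasure (P (Some x)) {\<omega> \<in> space M. X u \<omega> \<in> Some ` B}"
    using X_in_sets_F[OF Some_image_borel[OF assms], of u] sets_F_subset[of u]
    by (intro nn_integral_indicator) (auto simp: sets_P)
  finally show ?thesis .
qed

lemma subprob_K: "subprob_space (K u x)"
proof
  interpret prob_space "P (Some x)" by (rule prob_space_P)
  show "emeasure (K u x) (space (K u x)) \<le> 1"
    by (simp add: emeasure_K emeasure_le_1)
qed simp

lemma measurable_K: "u < \<infinity> \<Longrightarrow> K u \<in> measurable borel (subprob_algebra borel)"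
proof (rule measurable_subprob_algebra)
  fix B :: "'a set" assume u: "u < \<infinity>" and B: "B \<in> sets borel"
  have "emeasure (K u x) B = ennreal (measure (P (Some x)) {\<omega> \<in> space M. X u \<omega> \<in> Some ` B})" for x
  proof -
    interpret prob_space "P (Some x)" by (rule prob_space_P)
    show ?thesis by (simp add: emeasure_K[OF B] emeasure_eq_measure)
  qed
  then show "(\<lambda>x. emeasure (K u x) B) \<in> borel_measurable borel"
    using P_measurable[OF u B] by simp
qed (auto simp: subprob_K)

lemma tendsto_path:
  fixes g :: "'a \<Rightarrow> real"
  assumes g: "continuous_on UNIV g" "bounded {z. g z \<noteq> 0}"
    and "\<omega> \<in> space M" "t < \<infinity>" "\<And>n. t < \<tau> n" "\<tau> \<longlonglongrightarrow> t"
  shows "(\<lambda>n. case_option 0 g (X (\<tau> n) \<omega>)) \<longlonglongrightarrow> case_option 0 g (X t \<omega>)"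
proof -
  have "filterlim \<tau> (at_right t) sequentially"
    using assms by (auto simp: filterlim_at less_imp_neq[symmetric] order.strict_implies_not_eq
        intro!: always_eventually)
  then show ?thesis
    using tendsto_case_option_state[OF g right_continuous_paths[OF assms(3,4)]]
    by (rule filterlim_compose[rotated])
qed

subsection \<open>Joint measurability and the potential kernel\<close>

lemma measurable_paths:
  fixes f :: "'a \<Rightarrow> ennreal"
  assumes f: "f \<in> borel_measurable borel"
  shows "(\<lambda>(u, \<omega>). case_option 0 f (X (ennreal u) \<omega>)) \<in> borel_measurable (borel \<Otimes>\<^sub>M M)"
proof -
  \<comment> \<open>Viewing positions as Dirac kernels reduces the claim to continuous test functions.\<close>
  define L :: "real \<times> 'w \<Rightarrow> 'a measure" where
    "L = (\<lambda>(u, \<omega>). case X (ennreal u) \<omega> of None \<Rightarrow> null_measure borel | Some z \<Rightarrow> return borel z)"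
  have L: "(\<integral>\<^sup>+z. h z \<partial>L (u, \<omega>)) = case_option 0 h (X (ennreal u) \<omega>)"
    if "h \<in> borel_measurable borel" for h u \<omega>
    using that unfolding L_def by (auto simp: nn_integral_return split: option.splits)
  have "L \<in> measurable (borel \<Otimes>\<^sub>M M) (subprob_algebra borel)"
  proof (rule measurable_kernel_compact_support)
    show "subprob_space (L i)" for i
      unfolding L_def
      by (auto split: prod.splits option.splits intro!: subprob_space_null_measure
          prob_space_imp_subprob_space[OF prob_space_return])
    show "sets (L i) = sets borel" for i
      unfolding L_def by (auto split: prod.splits option.splits)
    fix g :: "'a \<Rightarrow> real"
    assume g: "continuous_on UNIV g" "bounded {z. g z \<noteq> 0}"
    have [measurable]: "g \<in> borel_measurable borel"
      using g by (intro borel_measurable_continuous_onI)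
    have "(\<lambda>(u, \<omega>). case_option 0 g (X (ennreal u) \<omega>)) \<in> borel_measurable (borel \<Otimes>\<^sub>M M)"
      using tendsto_path[OF g] X_measurable[measurable]
      by (intro measurable_right_continuous) auto
    then have "(\<lambda>i. ennreal (case_option 0 g (X (ennreal (fst i)) (snd i)))) \<in> borel_measurable (borel \<Otimes>\<^sub>M M)"
      by (simp add: case_prod_beta')
    moreover have "(\<integral>\<^sup>+z. ennreal (g z) \<partial>L i) = ennreal (case_option 0 g (X (ennreal (fst i)) (snd i)))" for i
      using L[of "\<lambda>z. ennreal (g z)" "fst i" "snd i"] by (auto split: option.splits)
    ultimately show "(\<lambda>i. \<integral>\<^sup>+z. ennreal (g z) \<partial>L i) \<in> borel_measurable (borel \<Otimes>\<^sub>M M)"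
      by simp
  qed
  then have "(\<lambda>i. \<integral>\<^sup>+z. f z \<partial>L i) \<in> borel_measurable (borel \<Otimes>\<^sub>M M)"
    using nn_integral_measurable_subprob_algebra[OF f] by (rule measurable_compose)
  then show ?thesis
    by (simp add: L[OF f, symmetric] case_prod_beta')
qed

lemma measurable_paths_P [measurable (raw)]:
  fixes f :: "'a \<Rightarrow> ennreal"
  assumes [measurable]: "f \<in> borel_measurable borel" "h \<in> borel_measurable N" "k \<in> measurable N (P x)"
  shows "(\<lambda>i. case_option 0 f (X (ennreal (h i)) (k i))) \<in> borel_measurable N"
proof -
  have [measurable]: "k \<in> measurable N M"
    using assms(3) measurable_cong_sets[OF refl sets_P] by blast
  have "(\<lambda>i. (h i, k i)) \<in> measurable N (borel \<Otimes>\<^sub>M M)"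
    by measurable
  from measurable_compose[OF this measurable_paths[OF assms(1)]] show ?thesis by simp
qed

text \<open>Against a bounded continuous test function of bounded support, the kernel is measurable
  in \<open>x\<close> at each fixed time. It is right-continuous in time, by right continuity of the
  paths and dominated convergence. The two preceding measurability criteria combine these
  facts.\<close>

lemma measurable_K_joint:
  "(\<lambda>(u, x). K (ennreal u) x) \<in> measurable (borel \<Otimes>\<^sub>M borel) (subprob_algebra borel)"
proof (rule measurable_kernel_compact_support)
  fix g :: "'a \<Rightarrow> real"
  assume g: "continuous_on UNIV g" "\<And>z. 0 \<le> g z" "\<And>z. g z \<le> 1" "bounded {z. g z \<noteq> 0}"
  have [measurable]: "g \<in> borel_measurable borel"
    using g by (intro borel_measurable_continuous_onI)
  have bd: "0 \<le> case_option 0 g y" "case_option 0 g y \<le> 1" for y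
    using g by (auto split: option.splits)
  have int: "integrable (P y) (\<lambda>\<omega>. case_option 0 g (X u \<omega>))" for u y
  proof -
    interpret prob_space "P y" by (rule prob_space_P)
    show ?thesis using bd by (intro integrable_const_bound[of _ 1]) (auto intro!: AE_I2)
  qed
  have eq: "(\<integral>\<^sup>+z. ennreal (g z) \<partial>K u x) = ennreal (\<integral>\<omega>. case_option 0 g (X u \<omega>) \<partial>P (Some x))" for u x
  proof -
    have "(\<integral>\<^sup>+z. ennreal (g z) \<partial>K u x) = (\<integral>\<^sup>+\<omega>. ennreal (case_option 0 g (X u \<omega>)) \<partial>P (Some x))"
      by (subst nn_integral_K) (auto intro!: nn_integral_cong split: option.splits)
    also have "\<dots> = ennreal (\<integral>\<omega>. case_option 0 g (X u \<omega>) \<partial>P (Some x))"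
      using int bd by (intro nn_integral_eq_integral) auto
    finally show ?thesis .
  qed
  have "(\<lambda>(u, x). \<integral>\<omega>. case_option 0 g (X (ennreal u) \<omega>) \<partial>P (Some x))
      \<in> borel_measurable (borel \<Otimes>\<^sub>M borel)"
  proof (rule measurable_right_continuous)
    fix t :: ennreal assume t: "t < \<infinity>"
    have "(\<lambda>x. enn2real (\<integral>\<^sup>+z. ennreal (g z) \<partial>K t x)) \<in> borel_measurable borel"
      using measurable_compose[OF measurable_K[OF t] nn_integral_measurable_subprob_algebra, of "\<lambda>z. ennreal (g z)"]
      by measurable
    then show "(\<lambda>x. \<integral>\<omega>. case_option 0 g (X t \<omega>) \<partial>P (Some x)) \<in> borel_measurable borel"
      using bd by (simp add: eq integral_nonneg)
    fix x :: 'a and \<tau> :: "nat \<Rightarrow> ennreal"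
    assume \<tau>: "\<And>n. t < \<tau> n" "\<tau> \<longlonglongrightarrow> t"
    interpret prob_space "P (Some x)" by (rule prob_space_P)
    show "(\<lambda>n. \<integral>\<omega>. case_option 0 g (X (\<tau> n) \<omega>) \<partial>P (Some x))
        \<longlonglongrightarrow> (\<integral>\<omega>. case_option 0 g (X t \<omega>) \<partial>P (Some x))"
    proof (rule integral_dominated_convergence[where w="\<lambda>_. 1"])
      show "AE \<omega> in P (Some x). (\<lambda>n. case_option 0 g (X (\<tau> n) \<omega>)) \<longlonglongrightarrow> case_option 0 g (X t \<omega>)"
        using t \<tau> by (intro AE_I2 tendsto_path g) (auto simp: space_P)
    qed (use bd in \<open>auto intro!: AE_I2\<close>)
  qed
  then show "(\<lambda>i. \<integral>\<^sup>+z. ennreal (g z) \<partial>(case i of (u, x) \<Rightarrow> K (ennreal u) x)) \<in> borel_measurable (borel \<Otimes>\<^sub>M borel)"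
    by (simp add: case_prod_beta' eq)
qed (auto simp: subprob_K)

lemma measurable_the_path:
  "(\<lambda>(u, \<omega>). the (X (ennreal u) \<omega>)) \<in> measurable (borel \<Otimes>\<^sub>M M) borel"
proof (rule measurableI)
  fix B :: "'a set" assume B: "B \<in> sets borel"
  \<comment> \<open>\<open>h B\<close> takes the value 1 exactly where the path is alive and in
    \<open>B\<close>, and \<open>h UNIV\<close> takes the value 0 exactly where it is dead. The
    second set enters when \<open>the None\<close> happens to lie in \<open>B\<close>.\<close>
  define h where "h B = (\<lambda>(u, \<omega>). case_option 0 (indicator B :: 'a \<Rightarrow> ennreal) (X (ennreal u) \<omega>))" for B
  have m: "h B \<in> borel_measurable (borel \<Otimes>\<^sub>M M)" if "B \<in> sets borel" for B
    using that unfolding h_def by (intro measurable_paths) simp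
  have "(\<lambda>(u, \<omega>). the (X (ennreal u) \<omega>)) -` B \<inter> space (borel \<Otimes>\<^sub>M M)
      = (h B -` {1} \<inter> space (borel \<Otimes>\<^sub>M M)) \<union>
        (if the None \<in> B then h UNIV -` {0} \<inter> space (borel \<Otimes>\<^sub>M M) else {})"
    by (auto simp: h_def indicator_def split: option.splits if_splits) (metis not_None_eq)
  also have "\<dots> \<in> sets (borel \<Otimes>\<^sub>M M)"
    using measurable_sets[OF m[OF B], of "{1}"] measurable_sets[OF m[of UNIV], of "{0}"]
    by (intro sets.Un) auto
  finally show "(\<lambda>(u, \<omega>). the (X (ennreal u) \<omega>)) -` B \<inter> space (borel \<Otimes>\<^sub>M M) \<in> sets (borel \<Otimes>\<^sub>M M)" .
qed simp

lemma nn_integral_G: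
  assumes f [measurable]: "f \<in> borel_measurable borel"
  shows "(\<integral>\<^sup>+z. f z \<partial>G lam t x) =
      (\<integral>\<^sup>+u\<in>{u. 0 \<le> u \<and> ennreal u < t}. ennreal (exp (- lam * u)) *
        (\<integral>\<^sup>+\<omega>. case_option 0 f (X (ennreal u) \<omega>) \<partial>P (Some x)) \<partial>lborel)"
proof -
  interpret prob_space "P (Some x)" by (rule prob_space_P)
  \<comment> \<open>The last factor indicates survival at time \<open>u\<close>, so the arbitrary
    point \<open>the None\<close> receives no mass from dead paths.\<close>
  define w where "w = (\<lambda>(u, \<omega>). ennreal (exp (- lam * u)) * indicator {u. 0 \<le> u \<and> ennreal u < t} u *
    case_option 0 (\<lambda>_. 1 :: ennreal) (X (ennreal u) \<omega>))"
  \<comment> \<open>An image measure, so that the set function defining \<open>G\<close> is countably additive for free.\<close>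
  define D where "D = distr (density (lborel \<Otimes>\<^sub>M P (Some x)) w) borel (\<lambda>(u, \<omega>). the (X (ennreal u) \<omega>))"
  have [measurable]: "w \<in> borel_measurable (lborel \<Otimes>\<^sub>M P (Some x))"
    unfolding w_def by measurable
  have [measurable]: "(\<lambda>(u, \<omega>). the (X (ennreal u) \<omega>)) \<in> measurable (lborel \<Otimes>\<^sub>M P (Some x)) borel"
    using measurable_the_path
    by (subst measurable_cong_sets[OF sets_pair_measure_cong[OF sets_lborel sets_P] refl])
  have D: "(\<integral>\<^sup>+z. g z \<partial>D) = (\<integral>\<^sup>+u\<in>{u. 0 \<le> u \<and> ennreal u < t}. ennreal (exp (- lam * u)) *
        (\<integral>\<^sup>+\<omega>. case_option 0 g (X (ennreal u) \<omega>) \<partial>P (Some x)) \<partial>lborel)"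
    if [measurable]: "g \<in> borel_measurable borel" for g
  proof -
    have "(\<integral>\<^sup>+z. g z \<partial>D) =
        (\<integral>\<^sup>+i. w i * g (case i of (u, \<omega>) \<Rightarrow> the (X (ennreal u) \<omega>)) \<partial>(lborel \<Otimes>\<^sub>M P (Some x)))"
      unfolding D_def by (simp add: nn_integral_distr nn_integral_density)
    also have "\<dots> = (\<integral>\<^sup>+u. \<integral>\<^sup>+\<omega>. w (u, \<omega>) * g (the (X (ennreal u) \<omega>)) \<partial>P (Some x) \<partial>lborel)"
      by (subst nn_integral_fst[symmetric]) auto
    also have "\<dots> = (\<integral>\<^sup>+u. \<integral>\<^sup>+\<omega>. (ennreal (exp (- lam * u)) * indicator {u. 0 \<le> u \<and> ennreal u < t} u) *
        case_option 0 g (X (ennreal u) \<omega>) \<partial>P (Some x) \<partial>lborel)"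
      unfolding w_def by (intro nn_integral_cong) (auto split: option.splits)
    also have "\<dots> = (\<integral>\<^sup>+u\<in>{u. 0 \<le> u \<and> ennreal u < t}. ennreal (exp (- lam * u)) *
        (\<integral>\<^sup>+\<omega>. case_option 0 g (X (ennreal u) \<omega>) \<partial>P (Some x)) \<partial>lborel)"
      by (intro nn_integral_cong) (auto simp: nn_integral_cmult indicator_def)
    finally show ?thesis .
  qed
  have "G lam t x = measure_of UNIV (sets borel) (emeasure D)"
    unfolding potential_kernel_def
  proof (rule measure_of_eq)
    fix B :: "'a set" assume "B \<in> sigma_sets UNIV (sets borel)"
    then have B [measurable]: "B \<in> sets borel"
      by (metis sets.sigma_sets_eq space_borel)
    have "emeasure (K (ennreal u) x) B = (\<integral>\<^sup>+\<omega>. case_option 0 (indicator B) (X (ennreal u) \<omega>) \<partial>P (Some x))" for u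
      by (subst nn_integral_K[symmetric]) auto
    moreover have "emeasure D B = (\<integral>\<^sup>+z. indicator B z \<partial>D)"
      by (simp add: D_def)
    ultimately show "(\<integral>\<^sup>+u\<in>{u. 0 \<le> u \<and> ennreal u < t}.
          ennreal (exp (- lam * u)) * emeasure (K (ennreal u) x) B \<partial>lborel) = emeasure D B"
      using D[of "indicator B"] by simp
  qed simp
  also have "\<dots> = D"
    using measure_of_of_measure[of D] by (simp add: D_def)
  finally have "G lam t x = D" .
  then show ?thesis
    using D[OF f] by simp
qed

subsection \<open>Markov property and first visits\<close>

text \<open>This is the strong Markov property at the constant stopping time \<open>s\<close>,
  integrated over \<open>A\<close>. Survival on \<open>A\<close> ensures that the process restarts
  from a Euclidean point, where the transition kernel describes its law.\<close>

lemma simple_markov_emeasure: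
  assumes s: "s < \<infinity>" and v: "v < \<infinity>" and A: "A \<in> sets (F s)" and alive: "\<And>\<omega>. \<omega> \<in> A \<Longrightarrow> X s \<omega> \<noteq> None"
    and B: "B \<in> sets borel"
  shows "emeasure (P x) (A \<inter> {\<omega> \<in> space M. X (s + v) \<omega> \<in> Some ` B}) =
    (\<integral>\<^sup>+\<omega>. indicator A \<omega> * emeasure (K v (the (X s \<omega>))) B \<partial>P x)"
proof -
  interpret prob_space "P x" by (rule prob_space_P)
  let ?T = "\<lambda>_::'w. s"
  let ?E = "{\<omega> \<in> space M. X (s + v) \<omega> \<in> Some ` B}"
  have T: "stopping_time F ?T" by (rule stopping_time_const)
  have sub: "sets (pre_sigma ?T) \<subseteq> sets (P x)"
  proof
    fix C assume "C \<in> sets (pre_sigma ?T)"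
    then have "{\<omega> \<in> C. s \<le> s} \<in> sets (F s)" using T by (rule sets_pre_sigmaD[rotated])
    then show "C \<in> sets (P x)" using sets_F_subset[of s] by (auto simp: sets_P)
  qed
  interpret finite_measure_subalgebra "P x" "pre_sigma ?T"
    by unfold_locales (auto simp: subalgebra_def space_P space_pre_sigma intro: subsetD[OF sub])
  \<comment> \<open>For a constant time, the set to be tested at \<open>t\<close> is all of
    \<open>A\<close> or empty.\<close>
  have "A \<in> sets (pre_sigma ?T)"
  proof (rule sets_pre_sigmaI[OF T])
    show "{\<omega> \<in> A. s \<le> t} \<in> sets (F t)" for t
      using A sets_F_mono[of s t] by (cases "s \<le> t") auto
  qed
  have [measurable]: "A \<in> sets (P x)" using A sets_F_subset[of s] by (auto simp: sets_P)
  have [measurable]: "?E \<in> sets (P x)"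
    using X_in_sets_F[OF Some_image_borel[OF B], of "s + v"] sets_F_subset[of "s + v"]
    by (auto simp: sets_P)
  \<comment> \<open>A real-valued version of the integrand, since the conditional expectation is
    real; the bound by 1 makes the passage through \<open>enn2real\<close> lossless.\<close>
  define h where "h \<omega> = indicator A \<omega> * enn2real (emeasure (K v (the (X s \<omega>))) B)" for \<omega>
  have [measurable]: "(\<lambda>\<omega>. emeasure (K v (the (X s \<omega>))) B) \<in> borel_measurable (P x)"
    using measurable_compose[OF _ measurable_emeasure_kernel[OF measurable_K[OF v] B], of "\<lambda>\<omega>. the (X s \<omega>)" "P x"]
    by measurable
  have [measurable]: "h \<in> borel_measurable (P x)" unfolding h_def by measurable
  have fin: "emeasure (K v y) B \<le> 1" for y
    using subprob_space.subprob_emeasure_le_1[OF subprob_K] .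
  have h: "0 \<le> h \<omega>" "h \<omega> \<le> 1" for \<omega>
    using fin[of "the (X s \<omega>)"] enn2real_mono[of _ 1] by (auto simp: h_def indicator_def)
  have "measure (P x) (A \<inter> ?E) = (\<integral>\<omega>\<in>A. indicator ?E \<omega> \<partial>P x)"
    unfolding set_lebesgue_integral_def
    by (simp add: indicator_inter_arith[symmetric])
  also have "\<dots> = (\<integral>\<omega>\<in>A. real_cond_exp (P x) (pre_sigma ?T) (indicator ?E) \<omega> \<partial>P x)"
    by (rule real_cond_exp_intA) (use \<open>A \<in> sets (pre_sigma ?T)\<close> in \<open>auto simp: less_top[symmetric]\<close>)
  also have "\<dots> = (\<integral>\<omega>. h \<omega> \<partial>P x)"
    unfolding set_lebesgue_integral_def
  proof (rule integral_cong_AE)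
    show "(\<lambda>\<omega>. indicat_real A \<omega> *\<^sub>R real_cond_exp (P x) (pre_sigma ?T) (indicator ?E) \<omega>) \<in> borel_measurable (P x)"
      by (simp add: borel_measurable_cond_exp2)
    show "AE \<omega> in P x. indicat_real A \<omega> *\<^sub>R real_cond_exp (P x) (pre_sigma ?T) (indicator ?E) \<omega> = h \<omega>"
      using strong_markov[OF T v Some_image_borel[OF B], of x]
    proof eventually_elim
      case (elim \<omega>)
      show ?case
      proof (cases "\<omega> \<in> A")
        case True
        then obtain y where "X s \<omega> = Some y" using alive by blast
        then show ?thesis using elim True
          by (simp add: h_def emeasure_K[OF B] measure_def)
      qed (simp add: h_def)
    qed
  qed simp
  finally have "emeasure (P x) (A \<inter> ?E) = ennreal (\<integral>\<omega>. h \<omega> \<partial>P x)"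
    by (simp add: emeasure_eq_measure)
  also have "\<dots> = (\<integral>\<^sup>+\<omega>. ennreal (h \<omega>) \<partial>P x)"
    using h by (intro nn_integral_eq_integral[symmetric] integrable_const_bound[of _ 1]) auto
  also have "\<dots> = (\<integral>\<^sup>+\<omega>. indicator A \<omega> * emeasure (K v (the (X s \<omega>))) B \<partial>P x)"
  proof (rule nn_integral_cong)
    fix \<omega>
    have "emeasure (K v (the (X s \<omega>))) B < \<infinity>"
      using fin[of "the (X s \<omega>)"] by (rule order.strict_trans1) simp
    then show "ennreal (h \<omega>) = indicator A \<omega> * emeasure (K v (the (X s \<omega>))) B"
      unfolding h_def by (simp add: indicator_def)
  qed
  finally show ?thesis .
qed

text \<open>Both sides are integrals of \<open>f\<close> against a measure: \<open>Q1\<close> is the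
  law of the later position on \<open>A\<close>, and \<open>Q2\<close> is the position at
  \<open>s\<close> on \<open>A\<close> followed by the kernel. The two measures agree on Borel sets
  by the previous lemma, which covers all nonnegative \<open>f\<close> at once.\<close>

lemma simple_markov:
  assumes s: "s < \<infinity>" and v: "v < \<infinity>" and A: "A \<in> sets (F s)" and alive: "\<And>\<omega>. \<omega> \<in> A \<Longrightarrow> X s \<omega> \<noteq> None"
    and f [measurable]: "f \<in> borel_measurable borel"
  shows "(\<integral>\<^sup>+\<omega>. indicator A \<omega> * case_option 0 f (X (s + v) \<omega>) \<partial>P x) =
    (\<integral>\<^sup>+\<omega>. indicator A \<omega> * (\<integral>\<^sup>+z. f z \<partial>K v (the (X s \<omega>))) \<partial>P x)"
proof -
  interpret prob_space "P x" by (rule prob_space_P)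
  have [measurable]: "A \<in> sets (P x)" using A sets_F_subset[of s] by (auto simp: sets_P)
  define Q1 where "Q1 = distr (density (P x) (indicator (A \<inter> {\<omega> \<in> space M. X (s + v) \<omega> \<noteq> None}))) borel
    (\<lambda>\<omega>. the (X (s + v) \<omega>))"
  define Q2 where "Q2 = density (P x) (indicator A) \<bind> (\<lambda>\<omega>. K v (the (X s \<omega>)))"
  have kern [measurable]: "(\<lambda>\<omega>. K v (the (X s \<omega>))) \<in> measurable (P x) (subprob_algebra borel)"
    by (rule measurable_compose[OF _ measurable_K[OF v]]) measurable
  then have kern': "(\<lambda>\<omega>. K v (the (X s \<omega>))) \<in> measurable (density (P x) (indicator A)) (subprob_algebra borel)"
    by simp
  have Q1: "(\<integral>\<^sup>+z. g z \<partial>Q1) = (\<integral>\<^sup>+\<omega>. indicator A \<omega> * case_option 0 g (X (s + v) \<omega>) \<partial>P x)"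
    if [measurable]: "g \<in> borel_measurable borel" for g
    unfolding Q1_def
    by (simp add: nn_integral_distr nn_integral_density del: not_None_eq)
       (auto intro!: nn_integral_cong simp: space_P indicator_def split: option.splits)
  have Q2: "(\<integral>\<^sup>+z. g z \<partial>Q2) = (\<integral>\<^sup>+\<omega>. indicator A \<omega> * (\<integral>\<^sup>+z. g z \<partial>K v (the (X s \<omega>))) \<partial>P x)"
    if [measurable]: "g \<in> borel_measurable borel" for g
    unfolding Q2_def nn_integral_bind[OF that kern']
    by (subst nn_integral_density) auto
  have "Q1 = Q2"
  proof (rule measure_eqI)
    show sets: "sets Q1 = sets Q2"
      unfolding Q1_def Q2_def using not_empty
      by (subst sets_bind[where N=borel]) (auto simp: space_P)
    fix B assume "B \<in> sets Q1"
    then have B [measurable]: "B \<in> sets borel" by (simp add: Q1_def)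
    have E: "{\<omega> \<in> space M. X (s + v) \<omega> \<in> Some ` B} \<in> sets (P x)"
      using X_in_sets_F[OF Some_image_borel[OF B], of "s + v"] sets_F_subset[of "s + v"]
      by (auto simp: sets_P)
    have "emeasure Q1 B = (\<integral>\<^sup>+z. indicator B z \<partial>Q1)" by (simp add: Q1_def)
    also have "\<dots> = (\<integral>\<^sup>+\<omega>. indicator A \<omega> * case_option 0 (indicator B) (X (s + v) \<omega>) \<partial>P x)"
      by (rule Q1) simp
    also have "\<dots> = (\<integral>\<^sup>+\<omega>. indicator (A \<inter> {\<omega> \<in> space M. X (s + v) \<omega> \<in> Some ` B}) \<omega> \<partial>P x)"
      by (rule nn_integral_cong) (auto simp: space_P indicator_def split: option.splits)
    also have "\<dots> = emeasure (P x) (A \<inter> {\<omega> \<in> space M. X (s + v) \<omega> \<in> Some ` B})"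
      using E by (intro nn_integral_indicator) auto
    also have "\<dots> = (\<integral>\<^sup>+\<omega>. indicator A \<omega> * (\<integral>\<^sup>+z. indicator B z \<partial>K v (the (X s \<omega>))) \<partial>P x)"
      using simple_markov_emeasure[OF s v A alive B] by simp
    also have "\<dots> = (\<integral>\<^sup>+z. indicator B z \<partial>Q2)"
      by (rule Q2[symmetric]) simp
    also have "\<dots> = emeasure Q2 B"
      using sets \<open>B \<in> sets Q1\<close> by simp
    finally show "emeasure Q1 B = emeasure Q2 B" .
  qed
  then show ?thesis using Q1[OF f] Q2[OF f] by simp
qed

lemma measurable_K_joint_P [measurable (raw)]:
  fixes f :: "'a \<Rightarrow> ennreal"
  assumes f: "f \<in> borel_measurable borel" and [measurable]: "h \<in> borel_measurable N" "k \<in> borel_measurable N"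
  shows "(\<lambda>i. \<integral>\<^sup>+z. f z \<partial>K (ennreal (h i)) (k i)) \<in> borel_measurable N"
proof -
  have "(\<lambda>i. (h i, k i)) \<in> measurable N (borel \<Otimes>\<^sub>M borel)" by measurable
  from measurable_compose[OF measurable_compose[OF this measurable_K_joint] nn_integral_measurable_subprob_algebra[OF f]]
  show ?thesis by simp
qed

text \<open>By Tonelli the Markov property at \<open>s\<close> can be applied separately for each
  delay \<open>v\<close>. After swapping back, the time integral is the potential of
  \<open>f\<close> from the position at \<open>s\<close>, a point of \<open>Y\<close>.\<close>

lemma occupation_after_le:
  assumes s: "0 \<le> s" and A: "A \<in> sets (F (ennreal s))"
    and Y: "\<And>\<omega>. \<omega> \<in> A \<Longrightarrow> X (ennreal s) \<omega> \<in> Some ` Y"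
    and f [measurable]: "f \<in> borel_measurable borel"
    and S: "\<And>y. y \<in> Y \<Longrightarrow> (\<integral>\<^sup>+z. f z \<partial>G lam (ennreal t) y) \<le> S"
  shows "(\<integral>\<^sup>+\<omega>. indicator A \<omega> * (\<integral>\<^sup>+v\<in>{0..<t}. ennreal (exp (- lam * v)) *
      case_option 0 f (X (ennreal (s + v)) \<omega>) \<partial>lborel) \<partial>P x) \<le> S * emeasure (P x) A"
proof -
  interpret prob_space "P x" by (rule prob_space_P)
  interpret pair_sigma_finite lborel "P x" ..
  have [measurable]: "A \<in> sets (P x)" using A sets_F_subset[of "ennreal s"] by (auto simp: sets_P)
  have alive: "X (ennreal s) \<omega> \<noteq> None" if "\<omega> \<in> A" for \<omega> using Y[OF that] by auto
  let ?w = "\<lambda>v. ennreal (exp (- lam * v)) * indicator {0..<t} v"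
  have "(\<integral>\<^sup>+\<omega>. indicator A \<omega> * (\<integral>\<^sup>+v\<in>{0..<t}. ennreal (exp (- lam * v)) *
      case_option 0 f (X (ennreal (s + v)) \<omega>) \<partial>lborel) \<partial>P x)
    = (\<integral>\<^sup>+\<omega>. \<integral>\<^sup>+v. ?w v * (indicator A \<omega> * case_option 0 f (X (ennreal (s + v)) \<omega>)) \<partial>lborel \<partial>P x)"
    by (intro nn_integral_cong, subst nn_integral_cmult[symmetric])
       (auto intro!: nn_integral_cong simp: mult_ac)
  also have "\<dots> = (\<integral>\<^sup>+v. \<integral>\<^sup>+\<omega>. ?w v * (indicator A \<omega> * case_option 0 f (X (ennreal (s + v)) \<omega>)) \<partial>P x \<partial>lborel)"
    by (rule Fubini') measurable
  also have "\<dots> = (\<integral>\<^sup>+v. \<integral>\<^sup>+\<omega>. ?w v * (indicator A \<omega> * (\<integral>\<^sup>+z. f z \<partial>K (ennreal v) (the (X (ennreal s) \<omega>)))) \<partial>P x \<partial>lborel)"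
  proof (rule nn_integral_cong)
    fix v :: real
    show "(\<integral>\<^sup>+\<omega>. ?w v * (indicator A \<omega> * case_option 0 f (X (ennreal (s + v)) \<omega>)) \<partial>P x) =
      (\<integral>\<^sup>+\<omega>. ?w v * (indicator A \<omega> * (\<integral>\<^sup>+z. f z \<partial>K (ennreal v) (the (X (ennreal s) \<omega>)))) \<partial>P x)"
    proof (cases "0 \<le> v")
      case True
      then show ?thesis
        using simple_markov[of "ennreal s" "ennreal v" A f x] A alive s
        by (subst (1 2) nn_integral_cmult) (auto simp: ennreal_plus)
    qed simp
  qed
  also have "\<dots> = (\<integral>\<^sup>+\<omega>. \<integral>\<^sup>+v. ?w v * (indicator A \<omega> * (\<integral>\<^sup>+z. f z \<partial>K (ennreal v) (the (X (ennreal s) \<omega>)))) \<partial>lborel \<partial>P x)"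
    by (rule Fubini'[symmetric]) measurable
  also have "\<dots> \<le> (\<integral>\<^sup>+\<omega>. S * indicator A \<omega> \<partial>P x)"
  proof (rule nn_integral_mono)
    fix \<omega>
    show "(\<integral>\<^sup>+v. ?w v * (indicator A \<omega> * (\<integral>\<^sup>+z. f z \<partial>K (ennreal v) (the (X (ennreal s) \<omega>)))) \<partial>lborel)
      \<le> S * indicator A \<omega>"
    proof (cases "\<omega> \<in> A")
      case True
      then obtain y where y: "X (ennreal s) \<omega> = Some y" "y \<in> Y" using Y by auto
      \<comment> \<open>On \<open>A\<close> the discounted integral of the kernels over the delays
        below \<open>t\<close> is the formula for \<open>G\<close> started at
        \<open>y\<close>.\<close>
      have "(\<integral>\<^sup>+v. ?w v * (indicator A \<omega> * (\<integral>\<^sup>+z. f z \<partial>K (ennreal v) (the (X (ennreal s) \<omega>)))) \<partial>lborel)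
          = (\<integral>\<^sup>+z. f z \<partial>G lam (ennreal t) y)"
        unfolding nn_integral_G[OF f] using True
        by (intro nn_integral_cong)
           (auto simp: y nn_integral_K[OF f] indicator_def ennreal_less_iff)
      then show ?thesis using S[OF y(2)] True by simp
    qed simp
  qed
  also have "\<dots> = S * emeasure (P x) A"
    by (simp add: nn_integral_cmult)
  finally show ?thesis .
qed

text \<open>Split according to the first visit \<open>s\<close>. What follows it costs at most
  \<open>S\<close> times the probability of \<open>A s\<close>, discounted by the start of the
  block. The events \<open>A s\<close> are disjoint, so these probabilities sum to at most
  1.\<close>

lemma occupation_block_finite_le:
  assumes D: "finite D" "D \<subseteq> {a..}" and a: "0 \<le> a" and lam: "0 \<le> lam" and U: "U \<in> sets borel"
    and f [measurable]: "f \<in> borel_measurable borel"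
    and S: "\<And>y. y \<in> U \<Longrightarrow> (\<integral>\<^sup>+z. f z \<partial>G lam (ennreal t) y) \<le> S"
  shows "(\<integral>\<^sup>+\<omega>. (\<integral>\<^sup>+u\<in>{u. a \<le> u \<and> u < a + t \<and> (\<exists>s\<in>D. s \<le> u \<and> X (ennreal s) \<omega> \<in> Some ` U)}.
      ennreal (exp (- lam * u)) * case_option 0 f (X (ennreal u) \<omega>) \<partial>lborel) \<partial>P x)
    \<le> ennreal (exp (- lam * a)) * S"
proof -
  interpret prob_space "P x" by (rule prob_space_P)
  \<comment> \<open>\<open>s\<close> is the first visit to \<open>U\<close> along \<open>D\<close>.\<close>
  define A where "A s = {\<omega> \<in> space M. X (ennreal s) \<omega> \<in> Some ` U \<and>
    (\<forall>r\<in>D. r < s \<longrightarrow> X (ennreal r) \<omega> \<notin> Some ` U)}" for s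
  define J where "J s \<omega> = (\<integral>\<^sup>+v\<in>{0..<t}. ennreal (exp (- lam * v)) *
      case_option 0 f (X (ennreal (s + v)) \<omega>) \<partial>lborel)" for s \<omega>
  have AF: "A s \<in> sets (F (ennreal s))" for s
  proof -
    have 1: "{\<omega> \<in> space M. X (ennreal r) \<omega> \<in> Some ` U} \<in> sets (F (ennreal s))" if "r \<le> s" for r
      using X_in_sets_F[OF Some_image_borel[OF U], of "ennreal r"]
        sets_F_mono[of "ennreal r" "ennreal s"] that by (auto simp: ennreal_leI)
    have "A s = {\<omega> \<in> space M. X (ennreal s) \<omega> \<in> Some ` U} -
        (\<Union>r\<in>{r\<in>D. r < s}. {\<omega> \<in> space M. X (ennreal r) \<omega> \<in> Some ` U})"
      by (auto simp: A_def)
    also have "\<dots> \<in> sets (F (ennreal s))"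
      using D by (intro sets.Diff 1 sets.finite_UN) auto
    finally show ?thesis .
  qed
  then have AP [measurable]: "A s \<in> sets (P x)" for s
    using sets_F_subset[of "ennreal s"] by (auto simp: sets_P)
  have "(\<integral>\<^sup>+\<omega>. (\<integral>\<^sup>+u\<in>{u. a \<le> u \<and> u < a + t \<and> (\<exists>s\<in>D. s \<le> u \<and> X (ennreal s) \<omega> \<in> Some ` U)}.
      ennreal (exp (- lam * u)) * case_option 0 f (X (ennreal u) \<omega>) \<partial>lborel) \<partial>P x)
    \<le> (\<integral>\<^sup>+\<omega>. (\<Sum>s\<in>D. ennreal (exp (- lam * a)) * (indicator (A s) \<omega> * J s \<omega>)) \<partial>P x)"
  proof (rule nn_integral_mono)
    fix \<omega> assume \<omega>: "\<omega> \<in> space (P x)"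
    define H where "H = {s\<in>D. X (ennreal s) \<omega> \<in> Some ` U}"
    let ?E = "{u. a \<le> u \<and> u < a + t \<and> (\<exists>s\<in>D. s \<le> u \<and> X (ennreal s) \<omega> \<in> Some ` U)}"
    let ?g = "\<lambda>u. ennreal (exp (- lam * u)) * case_option 0 f (X (ennreal u) \<omega>)"
    show "(\<integral>\<^sup>+u\<in>?E. ?g u \<partial>lborel)
      \<le> (\<Sum>s\<in>D. ennreal (exp (- lam * a)) * (indicator (A s) \<omega> * J s \<omega>))"
    proof (cases "H = {}")
      case True
      then have "?E = {}" by (auto simp: H_def)
      then show ?thesis by (simp only: ) simp
    next
      case False
      define s where "s = Min H"
      have fin: "finite H" using D by (simp add: H_def)
      have sH: "s \<in> H" using Min_in[OF fin False] by (simp add: s_def)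
      have le: "s \<le> r" if "r \<in> H" for r using fin that by (simp add: s_def)
      have sD: "s \<in> D" "a \<le> s" using sH D by (auto simp: H_def)
      have "\<omega> \<in> A s"
        using sH le \<omega> unfolding A_def by (force simp: H_def space_P)
      \<comment> \<open>Every time counted in \<open>?E\<close> comes after some visit along
        \<open>D\<close>, hence not before the first one.\<close>
      have "(\<integral>\<^sup>+u\<in>?E. ?g u \<partial>lborel) \<le> (\<integral>\<^sup>+u. ?g u * indicator {s..<a + t} u \<partial>lborel)"
      proof (rule nn_integral_mono)
        fix u
        have "u \<in> {s..<a + t}" if "u \<in> ?E" using that le by (force simp: H_def)
        then show "?g u * indicator ?E u \<le> ?g u * indicator {s..<a + t} u"
          by (intro mult_left_mono) (auto split: split_indicator)
      qed
      also have "\<dots> = (\<integral>\<^sup>+v. ?g (s + v) * indicator {s..<a + t} (s + v) \<partial>lborel)"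
        using \<omega> by (subst nn_integral_real_affine[where c=1 and t=s]) auto
      also have "\<dots> \<le> (\<integral>\<^sup>+v. ennreal (exp (- lam * a)) * (ennreal (exp (- lam * v)) *
          case_option 0 f (X (ennreal (s + v)) \<omega>) * indicator {0..<t} v) \<partial>lborel)"
      \<comment> \<open>Since \<open>s\<close> is at least \<open>a\<close>, the discount up to
        \<open>s\<close> is at most the discount up to \<open>a\<close>, and the remaining window,
        shifted by \<open>s\<close>, fits into \<open>{0..<t}\<close>.\<close>
      proof (rule nn_integral_mono)
        fix v
        have "exp (- lam * (s + v)) \<le> exp (- lam * a) * exp (- lam * v)"
          using mult_left_mono[OF sD(2) lam] by (simp add: mult_exp_exp algebra_simps)
        then have "ennreal (exp (- lam * (s + v))) \<le> ennreal (exp (- lam * a)) * ennreal (exp (- lam * v))"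
          by (simp add: ennreal_mult[symmetric] ennreal_leI)
        then have "?g (s + v) \<le> ennreal (exp (- lam * a)) * (ennreal (exp (- lam * v)) *
            case_option 0 f (X (ennreal (s + v)) \<omega>))"
          by (metis mult_right_mono zero_le mult.assoc)
        then show "?g (s + v) * indicator {s..<a + t} (s + v) \<le> ennreal (exp (- lam * a)) * (ennreal (exp (- lam * v)) *
          case_option 0 f (X (ennreal (s + v)) \<omega>) * indicator {0..<t} v)"
          using sD by (auto split: split_indicator)
      qed
      also have "\<dots> = ennreal (exp (- lam * a)) * (indicator (A s) \<omega> * J s \<omega>)"
        using \<omega> \<open>\<omega> \<in> A s\<close> unfolding J_def by (subst nn_integral_cmult) auto
      also have "\<dots> \<le> (\<Sum>s\<in>D. ennreal (exp (- lam * a)) * (indicator (A s) \<omega> * J s \<omega>))"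
        by (rule member_le_sum) (use sD D in auto)
      finally show ?thesis .
    qed
  qed
  also have "\<dots> = (\<Sum>s\<in>D. ennreal (exp (- lam * a)) * (\<integral>\<^sup>+\<omega>. indicator (A s) \<omega> * J s \<omega> \<partial>P x))"
    unfolding J_def by (simp add: nn_integral_sum nn_integral_cmult)
  also have "\<dots> \<le> (\<Sum>s\<in>D. ennreal (exp (- lam * a)) * (S * emeasure (P x) (A s)))"
  proof (intro sum_mono mult_left_mono)
    fix s assume "s \<in> D"
    then show "(\<integral>\<^sup>+\<omega>. indicator (A s) \<omega> * J s \<omega> \<partial>P x) \<le> S * emeasure (P x) (A s)"
      unfolding J_def using D a
      by (intro occupation_after_le[where Y=U] AF S f) (auto simp: A_def)
  qed simp
  also have "\<dots> = ennreal (exp (- lam * a)) * (S * emeasure (P x) (\<Union>s\<in>D. A s))"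
  proof -
    have "disjoint_family_on A D"
      unfolding disjoint_family_on_def A_def by (auto simp: neq_iff)
    then have "(\<Sum>s\<in>D. emeasure (P x) (A s)) = emeasure (P x) (\<Union>s\<in>D. A s)"
      using D by (intro sum_emeasure) auto
    then show ?thesis by (simp add: sum_distrib_left[symmetric])
  qed
  also have "\<dots> \<le> ennreal (exp (- lam * a)) * (S * 1)"
    by (intro mult_left_mono emeasure_le_1) auto
  finally show ?thesis by simp
qed

text \<open>The image of \<open>U\<close> under \<open>Some\<close> is open in the compactification,
  so right continuity keeps the path in it for a while.\<close>

lemma path_in_open_right:
  assumes "\<omega> \<in> space M" "open U" "X (ennreal u) \<omega> \<in> Some ` U" "0 \<le> u"
  shows "\<exists>b>u. \<forall>r. u < r \<longrightarrow> r < b \<longrightarrow> X (ennreal r) \<omega> \<in> Some ` U"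
proof -
  have "\<forall>\<^sub>F s in at_right (ennreal u). X s \<omega> \<in> Some ` U"
    using right_continuous_paths[OF assms(1), of "ennreal u"] assms(2,3)
    by (auto simp: limitin_def)
  then obtain b where b: "ennreal u < b" "\<And>y. ennreal u < y \<Longrightarrow> y < b \<Longrightarrow> X y \<omega> \<in> Some ` U"
    using eventually_at_right[of "ennreal u" top] by auto
  \<comment> \<open>The bound \<open>b\<close> may be infinite; a point strictly below it is finite
    and yields a real bound.\<close>
  then obtain c where c: "ennreal u < c" "c < b" using dense by blast
  then obtain c' where c': "c = ennreal c'" "0 \<le> c'" by (cases c) auto
  show ?thesis
  proof (intro exI[of _ c'] conjI allI impI)
    show "u < c'" using c c' assms(4) by (simp add: ennreal_less_iff)
    fix r assume "u < r" "r < c'"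
    then have "ennreal u < ennreal r" "ennreal r < c"
      using assms(4) c' by (auto simp: ennreal_less_iff)
    then show "X (ennreal r) \<omega> \<in> Some ` U" using b c by (meson order.strict_trans)
  qed
qed

text \<open>Monotone convergence carries over the bound for finite sets of times. The sets
  \<open>E n \<omega>\<close> increase and contain almost every instant of the block spent in
  \<open>U\<close>; elsewhere \<open>f\<close> contributes nothing.\<close>

lemma occupation_block_le:
  assumes a: "0 \<le> a" and lam: "0 \<le> lam" and U: "open U"
    and f [measurable]: "f \<in> borel_measurable borel" and supp: "\<And>z. z \<notin> U \<Longrightarrow> f z = 0"
    and S: "\<And>y. y \<in> U \<Longrightarrow> (\<integral>\<^sup>+z. f z \<partial>G lam (ennreal t) y) \<le> S"
  shows "(\<integral>\<^sup>+\<omega>. (\<integral>\<^sup>+u\<in>{a..<a + t}.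
      ennreal (exp (- lam * u)) * case_option 0 f (X (ennreal u) \<omega>) \<partial>lborel) \<partial>P x)
    \<le> ennreal (exp (- lam * a)) * S"
proof -
  interpret prob_space "P x" by (rule prob_space_P)
  have [measurable]: "Some ` U \<in> sets state_borel" using U by (intro Some_image_borel) auto
  \<comment> \<open>An enumeration, with repetitions, of \<open>a\<close> plus the nonnegative
    rationals; \<open>max 0\<close> keeps every time at or after the start \<open>a\<close> of the
    block.\<close>
  define e where "e k = a + max 0 (of_rat (from_nat k))" for k :: nat
  have e_dense: "\<exists>k. u < e k \<and> e k < w" if uw: "a \<le> u" "u < w" for u w
  proof -
    obtain q where q: "u - a < of_rat q" "of_rat q < w - a"
      using of_rat_dense[of "u - a" "w - a"] uw by auto
    obtain k where "q = from_nat k" using surj_from_nat by (metis surjD)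
    then show ?thesis using q uw by (intro exI[of _ k]) (auto simp: e_def)
  qed
  define g where "g u \<omega> = ennreal (exp (- lam * u)) * case_option 0 f (X (ennreal u) \<omega>)" for u \<omega>
  define E where "E n \<omega> = {u. a \<le> u \<and> u < a + t \<and> (\<exists>s\<in>e ` {..<n}. s \<le> u \<and> X (ennreal s) \<omega> \<in> Some ` U)}" for n \<omega>
  have E_iff: "u \<in> E n \<omega> \<longleftrightarrow> a \<le> u \<and> u < a + t \<and> (\<exists>k\<in>{..<n}. e k \<le> u \<and> X (ennreal (e k)) \<omega> \<in> Some ` U)" for u n \<omega>
    by (auto simp: E_def)
  have E_mono: "E m \<omega> \<subseteq> E n \<omega>" if "m \<le> n" for m n \<omega>
    using that by (force simp: E_iff)
  have m: "(\<lambda>(\<omega>, u). g u \<omega> * indicator (E n \<omega>) u) \<in> borel_measurable (P x \<Otimes>\<^sub>M lborel)" for n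
    unfolding g_def indicator_def E_iff by measurable
  have inc: "incseq (\<lambda>n u. g u \<omega> * indicator (E n \<omega>) u)" for \<omega>
    using E_mono by (auto simp: incseq_def le_fun_def intro!: mult_left_mono split: split_indicator)
  have "(\<integral>\<^sup>+\<omega>. (\<integral>\<^sup>+u\<in>{a..<a + t}. g u \<omega> \<partial>lborel) \<partial>P x)
      = (\<integral>\<^sup>+\<omega>. (SUP n. \<integral>\<^sup>+u. g u \<omega> * indicator (E n \<omega>) u \<partial>lborel) \<partial>P x)"
  proof (rule nn_integral_cong)
    fix \<omega> assume \<omega>: "\<omega> \<in> space (P x)"
    then have \<omega>': "\<omega> \<in> space M" by (simp add: space_P)
    \<comment> \<open>the instants missed by all the finite sets of times: at most one\<close>
    define Z where "Z = {u. a \<le> u \<and> u < a + t \<and> X (ennreal u) \<omega> \<in> Some ` U} - (\<Union>n. E n \<omega>)"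
    \<comment> \<open>After \<open>u\<close> the path stays in \<open>U\<close> for a while, so some
      \<open>e k\<close> strictly between \<open>u\<close> and \<open>w\<close> is a visit. Then
      \<open>w\<close> comes after a visit and is not missed.\<close>
    have Z: "\<not> u < w" if uw: "u \<in> Z" "w \<in> Z" for u w
    proof
      assume "u < w"
      obtain b where b: "u < b" "\<And>r. u < r \<Longrightarrow> r < b \<Longrightarrow> X (ennreal r) \<omega> \<in> Some ` U"
        using path_in_open_right[OF \<omega>' U, of u] uw(1) a by (auto simp: Z_def)
      then obtain k where k: "u < e k" "e k < min b w"
        using e_dense[of u "min b w"] uw(1) \<open>u < w\<close> by (auto simp: Z_def)
      then have "w \<in> E (Suc k) \<omega>"
        unfolding E_iff using uw(2) b(2)[of "e k"] by (auto simp: Z_def intro!: bexI[of _ k])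
      then show False using uw(2) by (auto simp: Z_def)
    qed
    have "Z \<subseteq> {u}" if "u \<in> Z" for u
      using Z that by (metis insertI1 linorder_neqE subsetI)
    then have "countable Z"
      by (metis countable_empty countable_insert countable_subset all_not_in_conv)
    then have "AE u in lborel. u \<notin> Z"
      by (intro AE_not_in countable_imp_null_set_lborel)
    then have "AE u in lborel. g u \<omega> * indicator {a..<a + t} u = (SUP n. g u \<omega> * indicator (E n \<omega>) u)"
    proof eventually_elim
      case (elim u)
      show ?case
      proof (cases "\<exists>n. u \<in> E n \<omega>")
        case True
        then obtain n where n: "u \<in> E n \<omega>" by blast
        have "g u \<omega> * indicator {a..<a + t} u = g u \<omega> * indicator (E n \<omega>) u"
          using n by (auto simp: E_iff)
        also have "\<dots> \<le> (SUP n. g u \<omega> * indicator (E n \<omega>) u)"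
          by (rule SUP_upper) simp
        finally show ?thesis
          by (intro antisym SUP_least) (auto intro!: mult_left_mono split: split_indicator simp: E_iff)
      next
        \<comment> \<open>Away from \<open>Z\<close>, a time of the block outside every
          \<open>E n \<omega>\<close> finds the path outside \<open>U\<close> or dead; in both cases
          the integrand is 0.\<close>
        case False
        then have "g u \<omega> * indicator {a..<a + t} u = 0"
          using elim supp by (auto simp: Z_def g_def split: option.splits split_indicator)
        then show ?thesis using False by simp
      qed
    qed
    then have "(\<integral>\<^sup>+u\<in>{a..<a + t}. g u \<omega> \<partial>lborel) = (\<integral>\<^sup>+u. (SUP n. g u \<omega> * indicator (E n \<omega>) u) \<partial>lborel)"
      by (rule nn_integral_cong_AE)
    also have "\<dots> = (SUP n. \<integral>\<^sup>+u. g u \<omega> * indicator (E n \<omega>) u \<partial>lborel)"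
      using measurable_compose[OF measurable_Pair1'[OF \<omega>] m]
      by (intro nn_integral_monotone_convergence_SUP inc) auto
    finally show "(\<integral>\<^sup>+u\<in>{a..<a + t}. g u \<omega> \<partial>lborel) = (SUP n. \<integral>\<^sup>+u. g u \<omega> * indicator (E n \<omega>) u \<partial>lborel)" .
  qed
  also have "\<dots> = (SUP n. \<integral>\<^sup>+\<omega>. \<integral>\<^sup>+u. g u \<omega> * indicator (E n \<omega>) u \<partial>lborel \<partial>P x)"
  proof (rule nn_integral_monotone_convergence_SUP)
    show "incseq (\<lambda>n \<omega>. \<integral>\<^sup>+u. g u \<omega> * indicator (E n \<omega>) u \<partial>lborel)"
      using inc by (auto simp: incseq_def le_fun_def intro!: nn_integral_mono)
    show "(\<lambda>\<omega>. \<integral>\<^sup>+u. g u \<omega> * indicator (E n \<omega>) u \<partial>lborel) \<in> borel_measurable (P x)" for n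
      using lborel.borel_measurable_nn_integral[OF m[of n]] by simp
  qed
  also have "\<dots> \<le> ennreal (exp (- lam * a)) * S"
    unfolding g_def E_def
    by (intro SUP_least occupation_block_finite_le a lam f S) (use U in \<open>auto simp: e_def\<close>)
  finally show ?thesis by (simp add: g_def)
qed

text \<open>The block starting at \<open>n * t\<close> contributes at most
  \<open>exp (- lam * t) ^ n\<close> times \<open>S\<close>. The positive discount makes this
  geometric series converge.\<close>

lemma resolvent_le:
  assumes t: "0 < t" and lam: "0 < lam" and U: "open U"
    and f [measurable]: "f \<in> borel_measurable borel" and supp: "\<And>z. z \<notin> U \<Longrightarrow> f z = 0"
    and S: "\<And>y. y \<in> U \<Longrightarrow> (\<integral>\<^sup>+z. f z \<partial>G lam (ennreal t) y) \<le> S"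
  shows "(\<integral>\<^sup>+z. f z \<partial>G lam \<infinity> x) \<le> ennreal (1 / (1 - exp (- lam * t))) * S"
proof -
  interpret prob_space "P (Some x)" by (rule prob_space_P)
  interpret pair_sigma_finite lborel "P (Some x)" ..
  let ?g = "\<lambda>u \<omega>. ennreal (exp (- lam * u)) * case_option 0 f (X (ennreal u) \<omega>)"
  let ?I = "\<lambda>n. {real n * t..<real n * t + t}"
  have "(\<integral>\<^sup>+z. f z \<partial>G lam \<infinity> x) = (\<integral>\<^sup>+u. \<integral>\<^sup>+\<omega>. ?g u \<omega> * indicator {0..} u \<partial>P (Some x) \<partial>lborel)"
    unfolding nn_integral_G[OF f]
    by (intro nn_integral_cong) (auto simp: nn_integral_cmult indicator_def)
  also have "\<dots> \<le> (\<integral>\<^sup>+u. \<integral>\<^sup>+\<omega>. (\<Sum>n. ?g u \<omega> * indicator (?I n) u) \<partial>P (Some x) \<partial>lborel)"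
  proof (intro nn_integral_mono)
    fix u \<omega>
    show "?g u \<omega> * indicator {0..} u \<le> (\<Sum>n. ?g u \<omega> * indicator (?I n) u)"
    proof (cases "0 \<le> u")
      case True
      \<comment> \<open>The index of the block containing \<open>u\<close>. Keeping this single term
        of the series already dominates the left side.\<close>
      define n where "n = nat \<lfloor>u / t\<rfloor>"
      have "real n \<le> u / t" "u / t < real n + 1"
        using True t by (auto simp: n_def) 
      then have "u \<in> ?I n" using t by (simp add: field_simps)
      then have "?g u \<omega> * indicator {0..} u \<le> (\<Sum>i\<in>{n}. ?g u \<omega> * indicator (?I i) u)"
        using True by simp
      also have "\<dots> \<le> (\<Sum>n. ?g u \<omega> * indicator (?I n) u)"
        by (rule sum_le_suminf) auto
      finally show ?thesis .
    qed simp
  qed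
  also have "\<dots> = (\<Sum>n. \<integral>\<^sup>+u. \<integral>\<^sup>+\<omega>. ?g u \<omega> * indicator (?I n) u \<partial>P (Some x) \<partial>lborel)"
    by (simp add: nn_integral_suminf del: ennreal_suminf_cmult)
  also have "\<dots> = (\<Sum>n. \<integral>\<^sup>+\<omega>. (\<integral>\<^sup>+u\<in>?I n. ?g u \<omega> \<partial>lborel) \<partial>P (Some x))"
    by (subst Fubini') auto
  also have "\<dots> \<le> (\<Sum>n. ennreal (exp (- lam * (real n * t))) * S)"
    using t lam U by (intro suminf_le occupation_block_le U f supp S) auto
  also have "\<dots> = (\<Sum>n. ennreal (exp (- lam * t) ^ n)) * S"
    by (simp add: exp_of_nat_mult[symmetric] mult_ac)
  also have "(\<Sum>n. ennreal (exp (- lam * t) ^ n)) = ennreal (1 / (1 - exp (- lam * t)))"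
    using t lam by (intro suminf_ennreal_eq geometric_sums) auto
  finally show ?thesis .
qed

subsection \<open>Comparison of the resolvent with finite horizons\<close>

text \<open>One comparison serves both directions: the integrand and the horizon may grow, while
  \<open>c\<close> absorbs the change of discount rate before time \<open>s\<close>.\<close>

lemma nn_integral_G_mono:
  assumes [measurable]: "f \<in> borel_measurable borel" "g \<in> borel_measurable borel"
    and fg: "\<And>z. f z \<le> g z" and st: "s \<le> t" and c: "0 \<le> c"
    and exp: "\<And>u. 0 \<le> u \<Longrightarrow> ennreal u < s \<Longrightarrow> exp (- lam * u) \<le> c * exp (- mu * u)"
  shows "(\<integral>\<^sup>+z. f z \<partial>G lam s x) \<le> ennreal c * (\<integral>\<^sup>+z. g z \<partial>G mu t x)"
proof -
  interpret prob_space "P (Some x)" by (rule prob_space_P)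
  let ?E = "\<lambda>f u. \<integral>\<^sup>+\<omega>. case_option 0 f (X (ennreal u) \<omega>) \<partial>P (Some x)"
  have "(\<integral>\<^sup>+z. f z \<partial>G lam s x) \<le> (\<integral>\<^sup>+u. ennreal c *
      (ennreal (exp (- mu * u)) * ?E g u * indicator {u. 0 \<le> u \<and> ennreal u < t} u) \<partial>lborel)"
    unfolding nn_integral_G[OF assms(1)]
  proof (rule nn_integral_mono)
    fix u :: real
    show "ennreal (exp (- lam * u)) * ?E f u * indicator {u. 0 \<le> u \<and> ennreal u < s} u
      \<le> ennreal c * (ennreal (exp (- mu * u)) * ?E g u * indicator {u. 0 \<le> u \<and> ennreal u < t} u)"
    proof (cases "0 \<le> u \<and> ennreal u < s")
      case True
      have "?E f u \<le> ?E g u"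
        by (intro nn_integral_mono) (auto split: option.splits intro: fg)
      moreover have "ennreal (exp (- lam * u)) \<le> ennreal c * ennreal (exp (- mu * u))"
        using True exp[of u] c by (simp add: ennreal_mult[symmetric] ennreal_leI)
      ultimately have "ennreal (exp (- lam * u)) * ?E f u \<le> ennreal c * ennreal (exp (- mu * u)) * ?E g u"
        by (intro mult_mono) auto
      then show ?thesis using True st by (auto simp: mult.assoc)
    qed auto
  qed
  also have "\<dots> = ennreal c * (\<integral>\<^sup>+z. g z \<partial>G mu t x)"
    unfolding nn_integral_G[OF assms(2)]
    by (rule nn_integral_cmult) measurable
  finally show ?thesis .
qed

text \<open>On the bounded window below \<open>t\<close>, the discount at rate \<open>lam\<close> is
  at most 1, and \<open>exp (- mu * u)\<close> is at least \<open>exp (- mu * t)\<close>. Hence the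
  truncated kernel is at most \<open>exp (mu * t)\<close> times the full resolvent kernel.\<close>

lemma kato_class_imp_small:
  assumes q: "q \<in> kato_class M X P" and t: "0 < t" and lam: "0 \<le> lam"
  shows "locally_uniformly_small q (G lam (ennreal t))"
proof -
  obtain mu where mu: "0 < mu" "locally_uniformly_small q (G mu \<infinity>)"
    and q_meas: "q \<in> borel_measurable borel"
    using q by (auto simp: kato_class_def)
  show ?thesis
  proof (rule locally_uniformly_small_mono[OF mu(2), of "ennreal (exp (mu * t))" 1])
    fix x r
    let ?f = "\<lambda>z. ennreal \<bar>q z\<bar> * indicator (ball x r) z"
    have "(\<integral>\<^sup>+z. ?f z \<partial>G lam (ennreal t) x) \<le> ennreal (exp (mu * t)) * (\<integral>\<^sup>+z. ?f z \<partial>G mu \<infinity> x)"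
    proof (rule nn_integral_G_mono)
      fix u assume u: "0 \<le> u" "ennreal u < ennreal t"
      then have "mu * u \<le> mu * t" "0 \<le> lam * u"
        using mu lam by (auto simp: ennreal_less_iff intro!: mult_left_mono)
      then have "- lam * u \<le> mu * t + - mu * u" by simp
      then show "exp (- lam * u) \<le> exp (mu * t) * exp (- mu * u)"
        by (simp add: mult_exp_exp)
    qed (auto intro!: measurable_abs_indicator_ball q_meas)
    also have "\<dots> \<le> ennreal (exp (mu * t)) * (SUP y. \<integral>\<^sup>+z\<in>ball y (1 * r). ennreal \<bar>q z\<bar> \<partial>G mu \<infinity> y)"
      by (intro mult_left_mono) (auto intro: SUP_upper)
    finally show "(\<integral>\<^sup>+z\<in>ball x r. ennreal \<bar>q z\<bar> \<partial>G lam (ennreal t) x)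
      \<le> ennreal (exp (mu * t)) * (SUP y. \<integral>\<^sup>+z\<in>ball y (1 * r). ennreal \<bar>q z\<bar> \<partial>G mu \<infinity> y)" .
  qed auto
qed

lemma small_imp_kato_class:
  assumes q: "q \<in> borel_measurable borel" and t: "0 < t" and lam: "0 \<le> lam"
    and small: "locally_uniformly_small q (G lam (ennreal t))"
  shows "q \<in> kato_class M X P"
proof -
  \<comment> \<open>A rate above \<open>lam\<close> is positive even when \<open>lam\<close> is 0,
    as the geometric series requires, and it only decreases the truncated potential.\<close>
  define mu where "mu = lam + 1"
  have "locally_uniformly_small q (G mu \<infinity>)"
  proof (rule locally_uniformly_small_mono[OF small, of "ennreal (1 / (1 - exp (- mu * t)))" 2])
    fix x and r :: real
    let ?f = "\<lambda>x r z. ennreal \<bar>q z\<bar> * indicator (ball x r) z"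
    let ?S = "SUP y. \<integral>\<^sup>+z\<in>ball y (2 * r). ennreal \<bar>q z\<bar> \<partial>G lam (ennreal t) y"
    show "(\<integral>\<^sup>+z\<in>ball x r. ennreal \<bar>q z\<bar> \<partial>G mu \<infinity> x) \<le> ennreal (1 / (1 - exp (- mu * t))) * ?S"
    proof (rule resolvent_le[where U="ball x r"])
      fix y assume y: "y \<in> ball x r"
      \<comment> \<open>The supremum \<open>?S\<close> uses balls centred at the starting point.
        After a restart that point is \<open>y\<close>, so the ball about \<open>x\<close> has to
        fit into one about \<open>y\<close>.\<close>
      have "ball x r \<subseteq> ball y (2 * r)"
      proof
        fix z assume "z \<in> ball x r"
        then show "z \<in> ball y (2 * r)"
          using y dist_triangle[of y z x] by (simp add: dist_commute)
      qed
      then have "(\<integral>\<^sup>+z. ?f x r z \<partial>G mu (ennreal t) y) \<le> ennreal 1 * (\<integral>\<^sup>+z. ?f y (2 * r) z \<partial>G lam (ennreal t) y)"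
        by (intro nn_integral_G_mono measurable_abs_indicator_ball q)
           (auto simp: mu_def algebra_simps intro!: mult_left_mono split: split_indicator)
      then have "(\<integral>\<^sup>+z. ?f x r z \<partial>G mu (ennreal t) y) \<le> (\<integral>\<^sup>+z. ?f y (2 * r) z \<partial>G lam (ennreal t) y)"
        by simp
      also have "\<dots> \<le> ?S" by (rule SUP_upper) simp
      finally show "(\<integral>\<^sup>+z. ?f x r z \<partial>G mu (ennreal t) y) \<le> ?S" .
    qed (use t lam in \<open>auto simp: mu_def intro!: measurable_abs_indicator_ball q\<close>)
  qed auto
  moreover have "0 < mu" using lam by (simp add: mu_def)
  ultimately show ?thesis using q by (auto simp: kato_class_def)
qed

end

theorem proposition3p6:
  fixes M :: "'w measure"
    and F :: "ennreal \<Rightarrow> 'w measure"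
    and X :: "ennreal \<Rightarrow> 'w \<Rightarrow> 'a::euclidean_space option"
    and \<theta> :: "ennreal \<Rightarrow> 'w \<Rightarrow> 'w"
    and P :: "'a option \<Rightarrow> 'w measure"
    and q :: "'a \<Rightarrow> real"
  assumes "hunt_process M F X \<theta> P"
    and "q \<in> borel_measurable borel"
  shows "(q \<in> kato_class M X P \<longleftrightarrow>
           (\<exists>t::real. \<exists>lam::real. 0 < t \<and> 0 \<le> lam \<and>
              locally_uniformly_small q (potential_kernel M X P lam (ennreal t)))) \<and>
         (q \<in> kato_class M X P \<longleftrightarrow>
           (\<forall>t::real. \<forall>lam::real. 0 < t \<longrightarrow> 0 \<le> lam \<longrightarrow>
              locally_uniformly_small q (potential_kernel M X P lam (ennreal t))))"
proof -
  interpret hunt_process M F X \<theta> P by (rule assms(1))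
  have 1: "locally_uniformly_small q (potential_kernel M X P lam (ennreal t))"
    if "q \<in> kato_class M X P" "0 < t" "0 \<le> lam" for lam t :: real
    using kato_class_imp_small that .
  have 2: "q \<in> kato_class M X P" if "0 < t" "0 \<le> lam"
    "locally_uniformly_small q (potential_kernel M X P lam (ennreal t))" for lam t :: real
    using small_imp_kato_class[OF assms(2) that] .
  \<comment> \<open>Passing from all parameters to some requires one admissible pair, such as
    \<open>t = 1\<close> and \<open>lam = 0\<close>.\<close>
  show ?thesis
    using 1 2 zero_less_one order_refl by meson
qed

end
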